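(* Let $c_0,\gamma_0,\lambda_0,\alpha,T>0$ and let the per-seat fleet and operation costs depend on the vehicle size $c$ by $\gamma=\frac{\gamma_0(c_0+\alpha c)}{c}$ and $\lambda=\frac{\lambda_0(c_0+\alpha c)}{c}$. Assume that the optimal peak-period dispatching rate satisfies $g_{pk}^*(t)=f(t)$ for $t\in[t_q-T,t_q)$. Consider the problem of choosing the vehicle size $c$ in the peak period to minimize $$\mathcal{J}_{pk}=\frac{\gamma_0(c_0+\alpha c)}{c}\int_{t_q-T}^{t_q}f(t)\,dt+\frac{\lambda_0(c_0+\alpha c)}{c}\left[(I+1)\int_{t_q-T}^{t_q}f(t)\,dt+\int_{t_q-T}^{t_q+\mathcal{T}_q-IT-T}f(t)\,dt\right]+\left[\frac{(T+\mathcal{T}_q)c}{2}+\int_{t_q}^{t_q+\mathcal{T}_q}\big(F(t)-G_{pk}^*(t)\big)\,dt\right],$$ where $I=\lfloor\mathcal{T}_q/T\rfloor$. Then the first-order condition $\frac{d\mathcal{J}_{pk}}{dc}=0$, for a vehicle size $c=c(t)$ that depends on the dispatch time $t\in[t_q-T,t_q)$, yields $$\tilde c_{pk}(t)=\begin{cases}\sqrt{\dfrac{2\big(\gamma_0c_0+\lambda_0c_0(I+2)\big)f(t)}{I+2}}, & t\in[t_q-T,\ t_q+\mathcal{T}_q-IT-T],\\[10pt] \sqrt{\dfrac{2\big(\gamma_0c_0+\lambda_0c_0(I+1)\big)f(t)}{I+1}}, & t\in(t_q+\mathcal{T}_q-IT-T,\ t_q).\end{cases}$$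
   Context: A single shuttle/feeder bus line has effective boarding demand arrival rate $f(t)$ and constant cycle time $T$. Buses are dispatched at rate $g(t)$ (seats per hour) from a fleet of $M$ seats. $\gamma$ is the fixed cost per seat in the fleet and $\lambda$ is the operation cost per dispatched seat. $t_q$ is the time when a queue of patrons first forms, $\mathcal{T}_q$ is the queue duration, and the peak period is $[t_q-T,t_q+\mathcal{T}_q]$. $F(t)=\int_{t_q-T}^{t}f(s)\,ds$ and $G_{pk}^*(t)=\int_{t_q-T}^{t}g_{pk}^*(s)\,ds$. The objective is obtained from $$\gamma M+\int_{t_q-T}^{t_q+\mathcal{T}_q}\lambda g_{pk}^*\,dt+\int_{t_q-T}^{t_q}\frac{cf(t)}{2g_{pk}^*(t)}\,dt+\int_{t_q}^{t_q+\mathcal{T}_q}\Big(\frac c2+F(t)-G_{pk}^*(t)\Big)dt$$ with $M=\int_{t_q-T}^{t_q}f(t)\,dt$ and $g_{pk}^*(t)=g_{pk}^*(t-T)$ on $[t_q,t_q+\mathcal{T}_q]$. The vehicle size during the queueing interval replicates that of one cycle earlier, $c(t)=c(t-T)$, so a choice of $c(t)$ on $[t_q-T,t_q)$ determines the vehicle size over the whole peak period. The first-order condition is taken pointwise in the dispatch time $t\in[t_q-T,t_q)$, after every term of $\mathcal{J}_{pk}$ depending on $c$ is written as an integral over $[t_q-T,t_q)$ by folding the later cycles back. *)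

theory Defs
  imports "HOL-Analysis.Analysis"
begin

definition seat_cost :: "real \<Rightarrow> real \<Rightarrow> real \<Rightarrow> real \<Rightarrow> real" where
  "seat_cost k c0 \<alpha> c = k * (c0 + \<alpha> * c) / c"

definition queue_length ::
  "real \<Rightarrow> real \<Rightarrow> (real \<Rightarrow> real) \<Rightarrow> (real \<Rightarrow> real) \<Rightarrow> real \<Rightarrow> real" where
  "queue_length tq T f g t = integral {tq - T..t} f - integral {tq - T..t} g"

text \<open>
  The peak-period cost of a time-dependent vehicle size \<open>c\<close>. The fleet consists of the
  \<open>f t\<close> seats per hour dispatched during the first cycle, so for constant \<open>c\<close> the
  first term is the fixed seat cost times the fleet size.
\<close>

definition peak_cost ::
  "real \<Rightarrow> real \<Rightarrow> real \<Rightarrow> real \<Rightarrow> real \<Rightarrow> real \<Rightarrow> real \<Rightarrow>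
   (real \<Rightarrow> real) \<Rightarrow> (real \<Rightarrow> real) \<Rightarrow> (real \<Rightarrow> real) \<Rightarrow> real" where
  "peak_cost c0 gamma0 lambda0 \<alpha> T tq Tq f g c =
     integral {tq - T..tq} (\<lambda>t. seat_cost gamma0 c0 \<alpha> (c t) * f t)
   + integral {tq - T..tq + Tq} (\<lambda>t. seat_cost lambda0 c0 \<alpha> (c t) * g t)
   + integral {tq - T..tq} (\<lambda>t. c t * f t / (2 * g t))
   + integral {tq..tq + Tq} (\<lambda>t. c t / 2 + queue_length tq T f g t)"

text \<open>
  Vehicle sizes are positive and repeat from one cycle to the next; the integrability
  conditions say exactly that the cost integrals depending on \<open>c\<close> exist.
\<close>

definition vehicle_size_profile ::
  "real \<Rightarrow> real \<Rightarrow> real \<Rightarrow> (real \<Rightarrow> real) \<Rightarrow> (real \<Rightarrow> real) \<Rightarrow> bool" where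
  "vehicle_size_profile T tq Tq f c \<longleftrightarrow>
     (\<forall>t\<in>{tq - T..<tq}. 0 < c t) \<and>
     (\<forall>t\<in>{tq..tq + Tq}. c t = c (t - T)) \<and>
     c integrable_on {tq - T..tq} \<and>
     (\<lambda>t. f t / c t) integrable_on {tq - T..tq}"

text \<open>
  The sum of \<open>h\<close> over all times in \<open>A\<close> that lie a whole number of cycles after \<open>t\<close>
  (finitely many if \<open>A\<close> is bounded and \<open>T > 0\<close>).
\<close>

definition fold_back :: "real \<Rightarrow> real set \<Rightarrow> (real \<Rightarrow> real) \<Rightarrow> real \<Rightarrow> real" where
  "fold_back T A h t = (\<Sum>k | t + real k * T \<in> A. h (t + real k * T))"

text \<open>
  The part of the cost integrand that depends on the vehicle size, folded back to the
  dispatch time \<open>t\<close> of the first cycle. Each term corresponds to one integral of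
  \<open>peak_cost\<close>; the size \<open>x\<close> chosen at \<open>t\<close> is used again at every \<open>t + k * T\<close>.
\<close>

definition folded_integrand ::
  "real \<Rightarrow> real \<Rightarrow> real \<Rightarrow> real \<Rightarrow> real \<Rightarrow> real \<Rightarrow> real \<Rightarrow>
   (real \<Rightarrow> real) \<Rightarrow> (real \<Rightarrow> real) \<Rightarrow> real \<Rightarrow> real \<Rightarrow> real" where
  "folded_integrand c0 gamma0 lambda0 \<alpha> T tq Tq f g t x =
     seat_cost gamma0 c0 \<alpha> x * f t
   + fold_back T {tq - T..tq + Tq} (\<lambda>s. seat_cost lambda0 c0 \<alpha> x * g s) t
   + x * f t / (2 * g t)
   + fold_back T {tq..tq + Tq} (\<lambda>s. x / 2) t"

definition first_order_condition ::
  "real \<Rightarrow> real \<Rightarrow> real \<Rightarrow> real \<Rightarrow> real \<Rightarrow> real \<Rightarrow> real \<Rightarrow>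
   (real \<Rightarrow> real) \<Rightarrow> (real \<Rightarrow> real) \<Rightarrow> (real \<Rightarrow> real) \<Rightarrow> bool" where
  "first_order_condition c0 gamma0 lambda0 \<alpha> T tq Tq f g c \<longleftrightarrow>
     (\<forall>t\<in>{tq - T..<tq}.
        ((\<lambda>x. folded_integrand c0 gamma0 lambda0 \<alpha> T tq Tq f g t x)
           has_real_derivative 0) (at (c t)))"

end

(* The dispatch rate repeats every cycle, and a whole number of cycles after a dispatch time t in
   [tq - T, tq) falls into the peak period exactly n(t) times, counting t itself, where n(t) = I + 2
   up to tq + Tq - I T - T and n(t) = I + 1 afterwards. Folding the later cycles back therefore
   gives the integrand gamma(x) f(t) + n(t) (lambda(x) f(t) + x / 2): the waiting term of the first
   cycle supplies x / 2 once and the queueing interval the other n(t) - 1 times. As a function of x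
   it is of the form const + A / x + n x / 2, stationary exactly at x^2 = 2 A / n. *)

theory Submission
  imports Defs
begin

text \<open>Split off the first period. What remains is the translate by \<open>T\<close> of the
  same stretch with one period fewer, so it has the integral given by the induction
  hypothesis.\<close>

lemma has_integral_periodic_extension:
  fixes h :: "real \<Rightarrow> real"
  assumes "h integrable_on {a..a + T}" and "0 \<le> R" and "R \<le> T"
    and "\<forall>t\<in>{a + T..a + real n * T + R}. h t = h (t - T)"
  shows "(h has_integral (real n * integral {a..a + T} h + integral {a..a + R} h))
           {a..a + real n * T + R}"
  using assms(4)
proof (induction n)
  case 0
  have "h integrable_on {a..a + R}"
    using assms(1-3) by (auto intro: integrable_on_subinterval)
  then show ?case by (simp add: integrable_integral)
next
  case (Suc n)
  have T0: "0 \<le> T" using assms by linarith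
  have nT: "0 \<le> real n * T" using T0 by simp
  have le: "a + T \<le> a + real (Suc n) * T + R"
    using assms(2) nT by (simp add: algebra_simps)
  have "h t = h (t - T)" if "t \<in> {a + T..a + real n * T + R}" for t
    using Suc.prems that T0 by (auto simp: algebra_simps)
  then have "(h has_integral (real n * integral {a..a + T} h + integral {a..a + R} h))
               (cbox a (a + real n * T + R))"
    using Suc.IH by simp
  \<comment> \<open>Substituting \<open>t - T\<close> moves the domain forward by one period;
    periodicity on the tail then turns \<open>h (t - T)\<close> back into
    \<open>h t\<close>.\<close>
  from has_integral_affinity[OF this, of 1 "- T"]
  have "((\<lambda>t. h (t - T)) has_integral
          (real n * integral {a..a + T} h + integral {a..a + R} h))
          {a + T..a + real (Suc n) * T + R}"
    by (simp add: algebra_simps image_affinity_atLeastAtMost split: if_splits)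
  then have tail: "(h has_integral (real n * integral {a..a + T} h + integral {a..a + R} h))
          {a + T..a + real (Suc n) * T + R}"
    by (rule has_integral_eq[rotated]) (use Suc.prems in auto)
  have "(h has_integral integral {a..a + T} h) {a..a + T}"
    using assms(1) by (rule integrable_integral)
  from has_integral_combine[OF _ le this tail] T0
  show ?case by (simp add: algebra_simps)
qed

section \<open>Counting the dispatches of the peak period that lie whole cycles apart\<close>

locale peak_period =
  fixes T tq Tq R :: real and f g :: "real \<Rightarrow> real" and m :: nat
  assumes T_pos: "0 < T"
    and Tq_eq: "Tq = real m * T + R" and R_nonneg: "0 \<le> R" and R_less: "R < T"
    and f_integrable: "f integrable_on {tq - T..tq + Tq}"
    and f_pos: "\<And>t. t \<in> {tq - T..<tq} \<Longrightarrow> 0 < f t"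
    and g_eq_f: "\<And>t. t \<in> {tq - T..<tq} \<Longrightarrow> g t = f t"
    and g_periodic: "\<And>t. t \<in> {tq..tq + Tq} \<Longrightarrow> g t = g (t - T)"
begin

text \<open>This is n(t) of the overview. The case split includes its endpoint because the peak
  period is closed: \<open>tq - T + R\<close> is carried exactly onto \<open>tq + Tq\<close> after
  \<open>m + 1\<close> cycles.\<close>

definition dispatches :: "real \<Rightarrow> nat" where
  "dispatches t = (if t \<le> tq - T + R then m + 2 else m + 1)"

lemma Tq_nonneg: "0 \<le> Tq"
  using Tq_eq R_nonneg T_pos by simp

text \<open>Return number \<open>dispatches t\<close> overshoots \<open>tq + Tq\<close>, and the
  return before it does not. For early \<open>t\<close> the overshoot comes from
  \<open>R < T\<close>; for late \<open>t\<close> the bound on the last return comes from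
  \<open>0 \<le> R\<close>.\<close>

lemma cycle_le_iff_less_dispatches:
  assumes "t \<in> {tq - T..<tq}"
  shows "t + real k * T \<le> tq + Tq \<longleftrightarrow> k < dispatches t"
proof
  assume le: "t + real k * T \<le> tq + Tq"
  show "k < dispatches t"
  proof (rule ccontr)
    assume "\<not> k < dispatches t"
    then have "real (dispatches t) * T \<le> real k * T"
      using T_pos by simp
    with le have "t + real (dispatches t) * T \<le> tq + Tq" by linarith
    then show False
      using assms R_less by (auto simp: dispatches_def Tq_eq algebra_simps split: if_splits)
  qed
next
  assume "k < dispatches t"
  then have "real (k + 1) * T \<le> real (dispatches t) * T"
    using T_pos by (intro mult_right_mono) auto
  then have "t + real k * T \<le> t + real (dispatches t) * T - T"
    by (simp add: algebra_simps)
  also have "\<dots> \<le> tq + Tq"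
    using assms R_nonneg by (auto simp: dispatches_def Tq_eq algebra_simps)
  finally show "t + real k * T \<le> tq + Tq" .
qed

lemma cycles_in_peak:
  assumes "t \<in> {tq - T..<tq}"
  shows "{k. t + real k * T \<in> {tq - T..tq + Tq}} = {..<dispatches t}"
proof -
  have "tq - T \<le> t + real k * T" for k
    using assms T_pos by (auto intro: add_increasing2)
  then show ?thesis
    using cycle_le_iff_less_dispatches[OF assms] by auto
qed

text \<open>Only \<open>k = 0\<close> falls before the queue, since \<open>t < tq\<close>; at
  \<open>t = tq\<close> itself the count would be different.\<close>

lemma cycles_in_queue:
  assumes "t \<in> {tq - T..<tq}"
  shows "{k. t + real k * T \<in> {tq..tq + Tq}} = {1..<dispatches t}"
proof -
  have "tq \<le> t + real k * T \<longleftrightarrow> 1 \<le> k" for k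
  proof (cases k)
    case (Suc j)
    have "0 \<le> real j * T" using T_pos by simp
    moreover have "t + real k * T = t + T + real j * T" by (simp add: Suc algebra_simps)
    moreover have "tq \<le> t + T" using assms by simp
    ultimately have "tq \<le> t + real k * T" by linarith
    then show ?thesis using Suc by simp
  qed (use assms in auto)
  then show ?thesis
    using cycle_le_iff_less_dispatches[OF assms] by auto
qed

text \<open>Periodicity of \<open>g\<close> is available only inside the queueing interval, so each
  step back by one cycle first checks that the return with index \<open>Suc k\<close> lies
  there.\<close>

lemma g_later_cycle:
  assumes "t \<in> {tq - T..<tq}" and "k < dispatches t"
  shows "g (t + real k * T) = f t"
  using assms(2)
proof (induction k)
  case 0
  then show ?case using g_eq_f assms by simp
next
  case (Suc k)
  have "Suc k \<in> {k. t + real k * T \<in> {tq..tq + Tq}}"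
    unfolding cycles_in_queue[OF assms(1)] using Suc.prems by auto
  then have "g (t + real (Suc k) * T) = g (t + real (Suc k) * T - T)"
    by (intro g_periodic) simp
  then show ?case using Suc by (simp add: algebra_simps)
qed

lemma folded_integrand_eq:
  assumes "t \<in> {tq - T..<tq}"
  shows "folded_integrand c0 gamma0 lambda0 \<alpha> T tq Tq f g t x =
    seat_cost gamma0 c0 \<alpha> x * f t
    + real (dispatches t) * (seat_cost lambda0 c0 \<alpha> x * f t + x / 2)"
proof -
  have "fold_back T {tq - T..tq + Tq} (\<lambda>s. seat_cost lambda0 c0 \<alpha> x * g s) t
      = (\<Sum>k<dispatches t. seat_cost lambda0 c0 \<alpha> x * f t)"
    unfolding fold_back_def cycles_in_peak[OF assms]
    by (rule sum.cong) (use g_later_cycle[OF assms] in auto)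
  \<comment> \<open>Unfolding \<open>dispatches\<close> shows that it is at least 1, so the
    natural-number cardinality of the index range agrees with the real difference.\<close>
  moreover have "fold_back T {tq..tq + Tq} (\<lambda>s. x / 2) t = (real (dispatches t) - 1) * (x / 2)"
    unfolding fold_back_def cycles_in_queue[OF assms]
    by (simp add: dispatches_def)
  moreover have "x * f t / (2 * g t) = x / 2"
    using f_pos[OF assms] g_eq_f[OF assms] by simp
  ultimately show ?thesis
    unfolding folded_integrand_def by (simp add: algebra_simps)
qed

section \<open>Folding integrals over the peak period into the first cycle\<close>

lemma has_integral_dispatches:
  assumes "h integrable_on {tq - T..tq}"
  shows "((\<lambda>t. real (dispatches t) * h t) has_integral
    (real (m + 1) * integral {tq - T..tq} h + integral {tq - T..tq - T + R} h)) {tq - T..tq}"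
proof -
  have sub: "{tq - T..tq - T + R} \<subseteq> {tq - T..tq}" using R_less by auto
  have "h integrable_on {tq - T..tq - T + R}"
    using assms sub by (rule integrable_on_subinterval)
  then have "(h has_integral integral {tq - T..tq - T + R} h) {tq - T..tq - T + R}"
    by (rule integrable_integral)
  \<comment> \<open>The weight is \<open>m + 1\<close> everywhere plus one extra on the initial
    segment of length \<open>R\<close>; extending by zero puts both summands on the same
    interval.\<close>
  then have "((\<lambda>t. if t \<in> {tq - T..tq - T + R} then h t else 0) has_integral
       integral {tq - T..tq - T + R} h) {tq - T..tq}"
    using has_integral_restrict[OF sub] by blast
  moreover have "((\<lambda>t. real (m + 1) * h t) has_integral real (m + 1) * integral {tq - T..tq} h)
      {tq - T..tq}"
    using assms by (intro has_integral_mult_right integrable_integral)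
  ultimately have "((\<lambda>t. real (m + 1) * h t + (if t \<in> {tq - T..tq - T + R} then h t else 0))
      has_integral (real (m + 1) * integral {tq - T..tq} h + integral {tq - T..tq - T + R} h))
      {tq - T..tq}"
    by (rule has_integral_add[rotated])
  then show ?thesis
    by (rule has_integral_eq[rotated]) (auto simp: dispatches_def algebra_simps)
qed

text \<open>The peak period has length \<open>(m + 1) * T + R\<close>, hence \<open>m + 1\<close>
  full copies of the first cycle and an initial piece of length \<open>R\<close>. The
  \<open>dispatches\<close> weight yields the same sum.\<close>

lemma has_integral_peak:
  assumes "h integrable_on {tq - T..tq}"
    and "\<And>t. t \<in> {tq..tq + Tq} \<Longrightarrow> h t = h (t - T)"
  shows "(h has_integral integral {tq - T..tq} (\<lambda>t. real (dispatches t) * h t)) {tq - T..tq + Tq}"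
  using has_integral_periodic_extension[of h "tq - T" T R "m + 1"] assms R_nonneg R_less
    integral_unique[OF has_integral_dispatches[OF assms(1)]]
  by (simp add: Tq_eq algebra_simps)

lemma f_integrable_cycle: "f integrable_on {tq - T..tq}"
  using f_integrable by (rule integrable_on_subinterval) (use Tq_nonneg in auto)

text \<open>The endpoint \<open>tq\<close> belongs to the next cycle, so congruence on \<open>{tq - T..<tq}\<close> must do.\<close>

lemma integrable_cycle_cong:
  fixes h k :: "real \<Rightarrow> real"
  assumes "h integrable_on {tq - T..tq}" and "\<And>t. t \<in> {tq - T..<tq} \<Longrightarrow> k t = h t"
  shows "k integrable_on {tq - T..tq}"
  using assms(1)
  by (rule integrable_spike_finite[where S = "{tq}", rotated 2]) (auto intro: assms(2))

lemma integral_cycle_cong: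
  fixes h k :: "real \<Rightarrow> real"
  assumes "\<And>t. t \<in> {tq - T..<tq} \<Longrightarrow> k t = h t"
  shows "integral {tq - T..tq} k = integral {tq - T..tq} h"
  by (rule integral_spike[where S = "{tq}"]) (auto simp: assms)

text \<open>A difference of two indefinite integrals is continuous. Integrability of
  \<open>g\<close> passes from \<open>f\<close> on the first cycle to the whole peak period by
  periodicity.\<close>

lemma queue_length_integrable: "queue_length tq T f g integrable_on {tq..tq + Tq}"
proof -
  have "g integrable_on {tq - T..tq}"
    using f_integrable_cycle by (rule integrable_cycle_cong) (rule g_eq_f)
  then have "g integrable_on {tq - T..tq + Tq}"
    using has_integral_peak g_periodic by (blast intro: has_integral_integrable)
  then have "continuous_on {tq - T..tq + Tq} (\<lambda>t. queue_length tq T f g t)"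
    unfolding queue_length_def
    by (intro continuous_intros indefinite_integral_continuous_1 f_integrable)
  then have "continuous_on {tq..tq + Tq} (queue_length tq T f g)"
    by (rule continuous_on_subset) (use T_pos in auto)
  then show ?thesis by (rule integrable_continuous_real)
qed

section \<open>The cost of an arbitrary vehicle size profile\<close>

context
  fixes c :: "real \<Rightarrow> real"
  assumes profile: "vehicle_size_profile T tq Tq f c"
begin

text \<open>Dividing out gives a multiple of \<open>f t / c t\<close> plus a multiple of
  \<open>f t\<close>, both integrable for a profile.\<close>

lemma seat_cost_integrable:
  "(\<lambda>t. seat_cost k c0 \<alpha> (c t) * f t) integrable_on {tq - T..tq}"
proof (rule integrable_cycle_cong)
  show "(\<lambda>t. k * c0 * (f t / c t) + k * \<alpha> * f t) integrable_on {tq - T..tq}"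
    using profile f_integrable_cycle unfolding vehicle_size_profile_def
    by (intro integrable_add integrable_on_mult_right) auto
  show "seat_cost k c0 \<alpha> (c t) * f t = k * c0 * (f t / c t) + k * \<alpha> * f t"
    if "t \<in> {tq - T..<tq}" for t
  proof -
    have "0 < c t" using profile that unfolding vehicle_size_profile_def by auto
    then show ?thesis by (simp add: seat_cost_def field_simps)
  qed
qed

lemma c_integrable: "c integrable_on {tq - T..tq}"
  using profile by (simp add: vehicle_size_profile_def)

lemma c_periodic: "t \<in> {tq..tq + Tq} \<Longrightarrow> c t = c (t - T)"
  using profile by (simp add: vehicle_size_profile_def)

lemma integral_operation_cost:
  "integral {tq - T..tq + Tq} (\<lambda>t. seat_cost k c0 \<alpha> (c t) * g t)
    = integral {tq - T..tq} (\<lambda>t. real (dispatches t) * (seat_cost k c0 \<alpha> (c t) * f t))"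
proof -
  have "((\<lambda>t. seat_cost k c0 \<alpha> (c t) * g t) has_integral
     integral {tq - T..tq} (\<lambda>t. real (dispatches t) * (seat_cost k c0 \<alpha> (c t) * g t)))
     {tq - T..tq + Tq}"
    by (rule has_integral_peak,
        rule integrable_cycle_cong[OF seat_cost_integrable[of k c0 \<alpha>]])
      (auto simp: g_eq_f g_periodic c_periodic)
  \<comment> \<open>Folding needs the periodic rate \<open>g\<close>; only afterwards, on the first
    cycle, is it replaced by \<open>f\<close>.\<close>
  also have "integral {tq - T..tq} (\<lambda>t. real (dispatches t) * (seat_cost k c0 \<alpha> (c t) * g t))
      = integral {tq - T..tq} (\<lambda>t. real (dispatches t) * (seat_cost k c0 \<alpha> (c t) * f t))"
    by (rule integral_cycle_cong) (simp add: g_eq_f)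
  finally show ?thesis by (rule integral_unique)
qed

text \<open>Since \<open>g\<close> is \<open>f\<close> on the first cycle, the waiting integrand
  there is \<open>c t / 2\<close>, as in the queue. The two intervals merge into the whole peak
  period and fold at once; the queue length integral is free of \<open>c\<close>.\<close>

lemma integral_waiting_cost:
  "integral {tq - T..tq} (\<lambda>t. c t * f t / (2 * g t))
    + integral {tq..tq + Tq} (\<lambda>t. c t / 2 + queue_length tq T f g t)
   = integral {tq - T..tq} (\<lambda>t. real (dispatches t) * (c t / 2))
    + integral {tq..tq + Tq} (queue_length tq T f g)"
proof -
  let ?h = "\<lambda>t. c t / 2"
  have h: "?h integrable_on {tq - T..tq}"
    using c_integrable by simp
  have peak: "(?h has_integral integral {tq - T..tq} (\<lambda>t. real (dispatches t) * ?h t))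
      {tq - T..tq + Tq}"
    by (rule has_integral_peak[OF h]) (simp add: c_periodic)
  then have "?h integrable_on {tq - T..tq + Tq}" by blast
  moreover from this have tail: "?h integrable_on {tq..tq + Tq}"
    by (rule integrable_on_subinterval) (use T_pos in auto)
  ultimately have "integral {tq - T..tq} ?h + integral {tq..tq + Tq} ?h
      = integral {tq - T..tq + Tq} ?h"
    using T_pos Tq_nonneg by (intro Henstock_Kurzweil_Integration.integral_combine) auto
  moreover have "integral {tq - T..tq} (\<lambda>t. c t * f t / (2 * g t)) = integral {tq - T..tq} ?h"
    by (rule integral_cycle_cong) (use f_pos in \<open>force simp: g_eq_f\<close>)
  moreover have "integral {tq..tq + Tq} (\<lambda>t. ?h t + queue_length tq T f g t)
      = integral {tq..tq + Tq} ?h + integral {tq..tq + Tq} (queue_length tq T f g)"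
    by (rule integral_add[OF tail queue_length_integrable])
  ultimately show ?thesis
    using integral_unique[OF peak] by simp
qed

lemma peak_cost_eq:
  "peak_cost c0 gamma0 lambda0 \<alpha> T tq Tq f g c =
     integral {tq - T..tq} (\<lambda>t. seat_cost gamma0 c0 \<alpha> (c t) * f t)
   + integral {tq - T..tq} (\<lambda>t. real (dispatches t) * (seat_cost lambda0 c0 \<alpha> (c t) * f t))
   + integral {tq - T..tq} (\<lambda>t. real (dispatches t) * (c t / 2))
   + integral {tq..tq + Tq} (queue_length tq T f g)"
  unfolding peak_cost_def integral_operation_cost
  using integral_waiting_cost by linarith

text \<open>This justifies a pointwise condition: up to a term independent of \<open>c\<close>, the
  cost is the integral of an integrand that sees \<open>c\<close> only through its value at
  \<open>t\<close>.\<close>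

lemma folded_integrand_has_integral:
  "((\<lambda>t. folded_integrand c0 gamma0 lambda0 \<alpha> T tq Tq f g t (c t)) has_integral
     (peak_cost c0 gamma0 lambda0 \<alpha> T tq Tq f g c
      - integral {tq..tq + Tq} (queue_length tq T f g))) {tq - T..tq}"
\<comment> \<open>The closed form of the integrand holds on the half-open cycle, so
  \<open>tq\<close> is discarded as a null set.\<close>
proof (rule has_integral_spike_finite[where S = "{tq}"])
  let ?n = "\<lambda>t. real (dispatches t)"
  show "((\<lambda>t. seat_cost gamma0 c0 \<alpha> (c t) * f t
       + ?n t * (seat_cost lambda0 c0 \<alpha> (c t) * f t) + ?n t * (c t / 2)) has_integral
     (peak_cost c0 gamma0 lambda0 \<alpha> T tq Tq f g c
      - integral {tq..tq + Tq} (queue_length tq T f g))) {tq - T..tq}"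
    unfolding peak_cost_eq add_diff_cancel_right'
    by (intro has_integral_add integrable_integral seat_cost_integrable
          has_integral_integrable[OF has_integral_dispatches])
      (simp_all add: c_integrable)
qed (auto simp: folded_integrand_eq algebra_simps)

end

section \<open>The cost of a constant vehicle size\<close>

lemma const_profile:
  assumes "0 < x"
  shows "vehicle_size_profile T tq Tq f (\<lambda>_. x)"
  using assms f_integrable_cycle by (auto simp: vehicle_size_profile_def)

lemma peak_cost_const:
  assumes "0 < x"
  shows "peak_cost c0 gamma0 lambda0 \<alpha> T tq Tq f g (\<lambda>_. x) =
        seat_cost gamma0 c0 \<alpha> x * integral {tq - T..tq} f
      + seat_cost lambda0 c0 \<alpha> x *
          (real (m + 1) * integral {tq - T..tq} f + integral {tq - T..tq - T + R} f)
      + ((T + Tq) * x / 2 + integral {tq..tq + Tq} (queue_length tq T f g))"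
proof -
  have "integral {tq - T..tq} (\<lambda>t. real (dispatches t) * (seat_cost lambda0 c0 \<alpha> x * f t))
      = seat_cost lambda0 c0 \<alpha> x *
          (real (m + 1) * integral {tq - T..tq} f + integral {tq - T..tq - T + R} f)"
    using integral_unique[OF has_integral_dispatches[OF f_integrable_cycle]]
    by (simp add: mult.left_commute)
  \<comment> \<open>Folding the constant 1 measures the length of the peak period, which is the
    coefficient of \<open>x / 2\<close>.\<close>
  moreover have "integral {tq - T..tq} (\<lambda>t. real (dispatches t)) = T + Tq"
    using integral_unique[OF has_integral_dispatches[OF integrable_const_ivl[of 1]]] T_pos R_nonneg
    by (simp add: Tq_eq algebra_simps)
  ultimately show ?thesis
    unfolding peak_cost_eq[OF const_profile[OF assms]] by simp
qed

end

section \<open>The stationary size at a single dispatch time\<close>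

lemma stationary_size_iff:
  fixes x p n :: real
  assumes "0 < x" and "0 < n"
  shows "((\<lambda>x. gamma0 * (c0 + \<alpha> * x) / x * p + n * (lambda0 * (c0 + \<alpha> * x) / x * p + x / 2))
      has_real_derivative 0) (at x) \<longleftrightarrow>
    x = sqrt (2 * (gamma0 * c0 + lambda0 * c0 * n) * p / n)"
    (is "(?F has_real_derivative 0) (at x) \<longleftrightarrow> x = sqrt ?y")
proof -
  \<comment> \<open>The \<alpha> part of each seat cost is constant in \<open>x\<close> and drops
    out of the derivative.\<close>
  let ?D = "n / 2 - (gamma0 * c0 + lambda0 * c0 * n) * p / x\<^sup>2"
  have deriv: "(?F has_real_derivative ?D) (at x)"
    using assms(1) by (auto intro!: derivative_eq_intros simp: field_simps power2_eq_square)
  have "(?F has_real_derivative 0) (at x) \<longleftrightarrow> ?D = 0"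
  proof
    assume "(?F has_real_derivative 0) (at x)"
    with deriv show "?D = 0" by (rule DERIV_unique)
  next
    assume "?D = 0"
    with deriv show "(?F has_real_derivative 0) (at x)" by (simp only:)
  qed
  also have "\<dots> \<longleftrightarrow> x\<^sup>2 = ?y"
    using assms by (simp add: field_simps)
  also have "\<dots> \<longleftrightarrow> x = sqrt ?y"
  proof
    assume "x = sqrt ?y"
    \<comment> \<open>Positivity of the radicand is read off from \<open>x\<close>, so that squaring
      the root returns it.\<close>
    moreover from this assms(1) have "0 < ?y" by (metis real_sqrt_gt_0_iff)
    ultimately show "x\<^sup>2 = ?y" by simp
  next
    assume "x\<^sup>2 = ?y"
    then show "x = sqrt ?y" using assms(1) by (intro real_sqrt_unique[symmetric]) auto
  qed
  finally show ?thesis .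
qed

section \<open>The cost formula, its folded form and the optimal sizes, in terms of the floor of
  \<open>Tq / T\<close>\<close>

theorem mainTheorem6:
  fixes c0 gamma0 lambda0 \<alpha> T tq Tq :: real
    and f g :: "real \<Rightarrow> real"
    and I :: int
  assumes "0 < c0" and "0 < gamma0" and "0 < lambda0" and "0 < \<alpha>" and "0 < T"
    and "0 \<le> Tq"
    and "I = \<lfloor>Tq / T\<rfloor>"
    and "f integrable_on {tq - T..tq + Tq}"
    and "\<forall>t\<in>{tq - T..<tq}. 0 < f t"
    and "\<forall>t\<in>{tq - T..<tq}. g t = f t"
    and "\<forall>t\<in>{tq..tq + Tq}. g t = g (t - T)"
  shows
    "(\<forall>c>0. peak_cost c0 gamma0 lambda0 \<alpha> T tq Tq f g (\<lambda>_. c) =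
        gamma0 * (c0 + \<alpha> * c) / c * integral {tq - T..tq} f
      + lambda0 * (c0 + \<alpha> * c) / c *
          ((of_int I + 1) * integral {tq - T..tq} f
           + integral {tq - T..tq + Tq - of_int I * T - T} f)
      + ((T + Tq) * c / 2
         + integral {tq..tq + Tq}
             (\<lambda>t. integral {tq - T..t} f - integral {tq - T..t} g)))
   \<and> (\<forall>c. vehicle_size_profile T tq Tq f c \<longrightarrow>
        (\<lambda>t. folded_integrand c0 gamma0 lambda0 \<alpha> T tq Tq f g t (c t))
          integrable_on {tq - T..tq} \<and>
        peak_cost c0 gamma0 lambda0 \<alpha> T tq Tq f g c =
          integral {tq - T..tq}
            (\<lambda>t. folded_integrand c0 gamma0 lambda0 \<alpha> T tq Tq f g t (c t))
        + integral {tq..tq + Tq} (queue_length tq T f g))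
   \<and> (\<forall>c. (\<forall>t\<in>{tq - T..<tq}. 0 < c t) \<longrightarrow>
        (first_order_condition c0 gamma0 lambda0 \<alpha> T tq Tq f g c \<longleftrightarrow>
          (\<forall>t\<in>{tq - T..tq + Tq - of_int I * T - T}.
             c t = sqrt (2 * (gamma0 * c0 + lambda0 * c0 * (of_int I + 2)) * f t
                         / (of_int I + 2))) \<and>
          (\<forall>t\<in>{tq + Tq - of_int I * T - T<..<tq}.
             c t = sqrt (2 * (gamma0 * c0 + lambda0 * c0 * (of_int I + 1)) * f t
                         / (of_int I + 1)))))"
proof -
  have I_nonneg: "0 \<le> I"
    using assms(5-7) by simp
  then have nat_I: "real (nat I) = of_int I" by simp
  have I_le: "of_int I * T \<le> Tq" and I_gr: "Tq < (of_int I + 1) * T"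
    using assms(5,7) by (simp_all add: floor_divide_lower floor_divide_upper)
  \<comment> \<open>By the floor bounds, \<open>Tq\<close> is \<open>I\<close> full cycles plus a
    remainder in the half-open range from 0 to \<open>T\<close>.\<close>
  interpret peak_period T tq Tq "Tq - of_int I * T" f g "nat I"
  proof
    show "Tq - of_int I * T < T" using I_gr by (simp add: algebra_simps)
  qed (use assms I_le I_nonneg in auto)
  have first_end: "tq - T + (Tq - of_int I * T) = tq + Tq - of_int I * T - T"
    by simp
  have first_end_less: "tq + Tq - of_int I * T - T < tq"
    using R_less by simp
  have n_eq: "real (dispatches t) =
      (if t \<le> tq + Tq - of_int I * T - T then of_int I + 2 else of_int I + 1)" for t
    by (simp add: dispatches_def first_end nat_I)

  have part1: "peak_cost c0 gamma0 lambda0 \<alpha> T tq Tq f g (\<lambda>_. c) =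
        gamma0 * (c0 + \<alpha> * c) / c * integral {tq - T..tq} f
      + lambda0 * (c0 + \<alpha> * c) / c *
          ((of_int I + 1) * integral {tq - T..tq} f
           + integral {tq - T..tq + Tq - of_int I * T - T} f)
      + ((T + Tq) * c / 2
         + integral {tq..tq + Tq}
             (\<lambda>t. integral {tq - T..t} f - integral {tq - T..t} g))" if "0 < c" for c
  proof -
    have "real (nat I + 1) = of_int I + 1" by (simp add: nat_I)
    then show ?thesis
      using peak_cost_const[OF that, of c0 gamma0 lambda0 \<alpha>]
      unfolding first_end by (simp only: seat_cost_def queue_length_def[abs_def])
  qed

  have part2: "(\<lambda>t. folded_integrand c0 gamma0 lambda0 \<alpha> T tq Tq f g t (c t))
          integrable_on {tq - T..tq} \<and>
        peak_cost c0 gamma0 lambda0 \<alpha> T tq Tq f g c =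
          integral {tq - T..tq}
            (\<lambda>t. folded_integrand c0 gamma0 lambda0 \<alpha> T tq Tq f g t (c t))
        + integral {tq..tq + Tq} (queue_length tq T f g)"
    if "vehicle_size_profile T tq Tq f c" for c
    using folded_integrand_has_integral[OF that, of c0 gamma0 lambda0 \<alpha>]
    by (auto dest: integral_unique)

  have part3: "first_order_condition c0 gamma0 lambda0 \<alpha> T tq Tq f g c \<longleftrightarrow>
          (\<forall>t\<in>{tq - T..tq + Tq - of_int I * T - T}.
             c t = sqrt (2 * (gamma0 * c0 + lambda0 * c0 * (of_int I + 2)) * f t
                         / (of_int I + 2))) \<and>
          (\<forall>t\<in>{tq + Tq - of_int I * T - T<..<tq}.
             c t = sqrt (2 * (gamma0 * c0 + lambda0 * c0 * (of_int I + 1)) * f t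
                         / (of_int I + 1)))" (is "_ \<longleftrightarrow> ?sizes")
    if c_pos: "\<forall>t\<in>{tq - T..<tq}. 0 < c t" for c
  proof -
    have "first_order_condition c0 gamma0 lambda0 \<alpha> T tq Tq f g c \<longleftrightarrow>
        (\<forall>t\<in>{tq - T..<tq}. c t = sqrt (2 * (gamma0 * c0
           + lambda0 * c0 * real (dispatches t)) * f t / real (dispatches t)))"
      unfolding first_order_condition_def
    proof (rule ball_cong[OF refl])
      fix t assume t: "t \<in> {tq - T..<tq}"
      show "((\<lambda>x. folded_integrand c0 gamma0 lambda0 \<alpha> T tq Tq f g t x)
              has_real_derivative 0) (at (c t)) \<longleftrightarrow>
          c t = sqrt (2 * (gamma0 * c0 + lambda0 * c0 * real (dispatches t)) * f t
                      / real (dispatches t))"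
        unfolding folded_integrand_eq[OF t] seat_cost_def
        by (rule stationary_size_iff) (use c_pos t in \<open>auto simp: dispatches_def\<close>)
    qed
    also have "\<dots> \<longleftrightarrow> ?sizes"
    proof -
      \<comment> \<open>The breakpoint is at least \<open>tq - T\<close> since
        \<open>I * T \<le> Tq\<close>, and strictly below \<open>tq\<close> since the remainder is
        less than \<open>T\<close>; so the closed first piece stays inside the half-open
        cycle.\<close>
      have "{tq - T..<tq} = {tq - T..tq + Tq - of_int I * T - T} \<union>
          {tq + Tq - of_int I * T - T<..<tq}"
        using first_end_less I_le by auto
      then show ?thesis unfolding n_eq by (simp add: ball_Un)
    qed
    finally show ?thesis .
  qed

  show ?thesis using part1 part2 part3 by blast
qed

end
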